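(* Let $0<\theta\le1$, $0\le\mu\le1$, let $(\tau_n)_{n\ge1}$ be positive step sizes with ratios $s_n:=\tau_n/\tau_{n-1}$ ($n\ge2$), and let $(u^n)_{n\ge0}$ be generated by the variable-step $(\theta,\mu)$-method, where $|u^0|=1$ a.e. in $\Omega$ and $u^1$ is computed by the linearly implicit Euler method (both described in the context). Then for all $m\ge2$, a.e. in $\Omega$, $$\begin{aligned}|u^m|^2-1&=\mu\tau_m^2|d_tu^m|^2+(1-\mu)\tau_1^2|d_tu^1|^2+\mu\sum_{n=1}^{m-1}\tau_n^2(1-s_{n+1}^2)|d_tu^n|^2\\&\quad+\mu\sum_{n=2}^m\tau_n^4|d_t^2u^n|^2+(1-2\mu)\sum_{n=2}^m\tau_n^2|d_tu^n|^2 .\end{aligned}$$ Thus, one has the constraint violation estimate $$\begin{aligned}\big\||u^m|^2-1\big\|_{L^1(\Omega)}&\le\mu\tau_m^2\|d_tu^m\|^2+(1-\mu)\tau_1^2\|d_tu^1\|^2+\mu\sum_{n=1}^{m-1}\tau_n^2|1-s_{n+1}^2|\,\|d_tu^n\|^2\\&\quad+\mu\sum_{n=2}^m\tau_n^4\|d_t^2u^n\|^2+|1-2\mu|\sum_{n=2}^m\tau_n^2\|d_tu^n\|^2 .\end{aligned}$$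
   Context: Setting. $\Omega\subset\mathbb{R}^d$ is a bounded domain with Lipschitz boundary, $\Gamma_D\subset\partial\Omega$ has positive surface measure, and $u_D:\Gamma_D\to\mathbb{R}^\ell$ is the trace of some $\tilde u_D\in H^1(\Omega;\mathbb{R}^\ell)$ with $|\tilde u_D|=1$ a.e. in $\Omega$. $H^1_D(\Omega;\mathbb{R}^\ell)$ is the subspace of $H^1(\Omega;\mathbb{R}^\ell)$ of functions with vanishing trace on $\Gamma_D$. $(\cdot,\cdot)$ and $\|\cdot\|$ are the $L^2(\Omega)$ inner product and norm; $|\cdot|$ is the Euclidean length and $\cdot$ between vectors the Euclidean inner product in $\mathbb{R}^\ell$ (applied pointwise to vector fields). $(\cdot,\cdot)_\star$ is either the $L^2$-inner product $(\cdot,\cdot)$ or the $H^1$-inner product $(\nabla\cdot,\nabla\cdot)$ on $H^1_D(\Omega;\mathbb{R}^\ell)$, with induced norm $\|\cdot\|_\star$. There is a constant $c_\star>0$ with $\|v\|\le c_\star^{1/2}\|v\|_\star$ for all $v\in H^1_D(\Omega;\mathbb{R}^\ell)$. The variable-step $(\theta,\mu)$-method. Given step sizes $\tau_n>0$, $n\ge1$, write $d_tu^n:=(u^n-u^{n-1})/\tau_n$ for $n\ge1$ and $d_t^2u^n:=(d_tu^n-d_tu^{n-1})/\tau_n$ for $n\ge2$. The starting value is $u^0\in H^1(\Omega;\mathbb{R}^\ell)$ with $u^0|_{\Gamma_D}=u_D$. Step 1 (linearly implicit Euler): $d_tu^1\in H^1_D(\Omega;\mathbb{R}^\ell)$ satisfies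 $d_tu^1\cdot u^0=0$ a.e. and $(d_tu^1,v)_\star+(\nabla u^0+\tau_1\nabla d_tu^1,\nabla v)=0$ for all $v\in H^1_D(\Omega;\mathbb{R}^\ell)$ with $v\cdot u^0=0$ a.e.; set $u^1:=u^0+\tau_1d_tu^1$. Step $n\ge2$: set $\widehat u^{\,n-1+\mu}:=u^{n-1}+\mu\tau_nd_tu^{n-1}$; $d_tu^n\in H^1_D(\Omega;\mathbb{R}^\ell)$ satisfies $d_tu^n\cdot\widehat u^{\,n-1+\mu}=0$ a.e. and $(d_tu^n,v)_\star+(\nabla[u^{n-1}+\theta\tau_nd_tu^n],\nabla v)=0$ for all $v\in H^1_D(\Omega;\mathbb{R}^\ell)$ with $v\cdot\widehat u^{\,n-1+\mu}=0$ a.e.; set $u^n:=u^{n-1}+\tau_nd_tu^n$. *)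

theory Defs
  imports "HOL-Analysis.Analysis"
begin

section \<open>Surface measure\<close>

text \<open>
  The surface measure on the boundary of a domain in \<open>real ^ 'd\<close> is the Hausdorff measure of
  dimension \<open>CARD('d) - 1\<close>, normalised so that the \<open>k\<close>-dimensional measure agrees with
  \<open>k\<close>-dimensional Lebesgue measure. The empty set is singled out in the gauge because
  \<open>diameter {} ^ 0 = 1\<close>, and covers consist of bounded sets because the library's
  \<open>diameter\<close> is unspecified on unbounded ones.
\<close>

definition hausdorff_gauge :: "nat \<Rightarrow> 'a::metric_space set \<Rightarrow> ennreal" where
  "hausdorff_gauge k C =
     (if C = {} then 0 else ennreal (unit_ball_vol (real k) * (diameter C / 2) ^ k))"

definition hausdorff_covers :: "real \<Rightarrow> 'a::metric_space set \<Rightarrow> (nat \<Rightarrow> 'a set) set" where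
  "hausdorff_covers \<delta> A =
     {C. A \<subseteq> (\<Union>i. C i) \<and> (\<forall>i. bounded (C i) \<and> diameter (C i) \<le> \<delta>)}"

definition hausdorff_pre :: "nat \<Rightarrow> real \<Rightarrow> 'a::metric_space set \<Rightarrow> ennreal" where
  "hausdorff_pre k \<delta> A = (INF C\<in>hausdorff_covers \<delta> A. \<Sum>i. hausdorff_gauge k (C i))"

definition hausdorff_outer :: "nat \<Rightarrow> 'a::metric_space set \<Rightarrow> ennreal" where
  "hausdorff_outer k A = (SUP \<delta>\<in>{0<..}. hausdorff_pre k \<delta> A)"

text \<open>
  The measurable sets are those satisfying the Caratheodory criterion. They include all Borel
  sets, since \<open>hausdorff_outer k\<close> is a metric outer measure.
\<close>

definition hausdorff_measure :: "nat \<Rightarrow> 'a::metric_space measure" where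
  "hausdorff_measure k =
     measure_of UNIV (lambda_system UNIV UNIV (hausdorff_outer k)) (hausdorff_outer k)"

lemma hausdorff_pre_mono:
  assumes "A \<subseteq> B"
  shows "hausdorff_pre k \<delta> A \<le> hausdorff_pre k \<delta> B"
  unfolding hausdorff_pre_def
  by (rule INF_superset_mono) (use assms in \<open>auto simp: hausdorff_covers_def\<close>)

lemma hausdorff_pre_empty:
  assumes "\<delta> > 0"
  shows "hausdorff_pre k \<delta> ({} :: 'a::metric_space set) = 0"
proof -
  have "(\<lambda>_. {}) \<in> hausdorff_covers \<delta> ({} :: 'a set)"
    using assms by (auto simp: hausdorff_covers_def)
  then have "hausdorff_pre k \<delta> ({} :: 'a set) \<le> (\<Sum>i::nat. hausdorff_gauge k ({} :: 'a set))"
    unfolding hausdorff_pre_def by (rule INF_lower)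
  then show ?thesis by (simp add: hausdorff_gauge_def)
qed

lemma hausdorff_pre_subadditive:
  "hausdorff_pre k \<delta> (\<Union>i. A i) \<le> (\<Sum>i. hausdorff_pre k \<delta> (A (i::nat)))"
proof (rule ennreal_le_epsilon)
  fix e :: real
  assume e: "0 < e" and fin: "(\<Sum>i. hausdorff_pre k \<delta> (A i)) < top"
  then have "hausdorff_pre k \<delta> (A n) < hausdorff_pre k \<delta> (A n) + e * (1/2)^Suc n" for n
    by (auto simp add: less_top dest!: ennreal_suminf_lessD)
  then have "\<exists>C. C \<in> hausdorff_covers \<delta> (A n) \<and>
      (\<Sum>i. hausdorff_gauge k (C i)) < hausdorff_pre k \<delta> (A n) + e * (1/2)^Suc n" for n
    by (subst (asm) (1) hausdorff_pre_def) (auto simp: INF_less_iff)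
  then obtain B where B: "\<And>n. B n \<in> hausdorff_covers \<delta> (A n)"
    and Ble: "\<And>n. (\<Sum>i. hausdorff_gauge k (B n i)) < hausdorff_pre k \<delta> (A n) + e * (1/2)^Suc n"
    by metis
  define C where "C = case_prod B \<circ> prod_decode"
  have "(\<Union>i. A i) \<subseteq> (\<Union>i. C i)"
  proof
    fix x assume "x \<in> (\<Union>i. A i)"
    then obtain n where "x \<in> A n" by blast
    with B[of n] obtain i where "x \<in> B n i"
      by (auto simp: hausdorff_covers_def)
    then have "x \<in> C (prod_encode (n, i))" by (simp add: C_def)
    then show "x \<in> (\<Union>i. C i)" by blast
  qed
  then have "C \<in> hausdorff_covers \<delta> (\<Union>i. A i)"
    using B by (auto simp: hausdorff_covers_def C_def split: prod.split)
  then have "hausdorff_pre k \<delta> (\<Union>i. A i) \<le> (\<Sum>i. hausdorff_gauge k (C i))"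
    unfolding hausdorff_pre_def by (rule INF_lower)
  also have "\<dots> = (\<Sum>n. \<Sum>i. hausdorff_gauge k (B n i))"
    using suminf_ennreal_2dimen[of "\<lambda>n. \<Sum>i. hausdorff_gauge k (B n i)"
        "\<lambda>p. hausdorff_gauge k (case_prod B p)"]
    by (simp add: C_def comp_def)
  also have "\<dots> \<le> (\<Sum>n. hausdorff_pre k \<delta> (A n) + e * (1/2) ^ Suc n)"
    using Ble by (intro suminf_le allI less_imp_le) auto
  also have "\<dots> = (\<Sum>n. hausdorff_pre k \<delta> (A n)) + (\<Sum>n. ennreal e * ennreal ((1/2) ^ Suc n))"
    using e by (subst suminf_add[symmetric])
      (auto simp del: ennreal_suminf_cmult simp add: ennreal_mult[symmetric])
  also have "\<dots> = (\<Sum>n. hausdorff_pre k \<delta> (A n)) + e"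
    unfolding ennreal_suminf_cmult
    by (subst suminf_ennreal_eq[OF zero_le_power power_half_series]) auto
  finally show "hausdorff_pre k \<delta> (\<Union>i. A i) \<le> (\<Sum>n. hausdorff_pre k \<delta> (A n)) + e" .
qed

lemma outer_measure_space_hausdorff: "outer_measure_space UNIV (hausdorff_outer k)"
proof -
  have "hausdorff_outer k {} = 0"
    by (auto simp: hausdorff_outer_def hausdorff_pre_empty)
  moreover have "hausdorff_outer k A \<le> hausdorff_outer k B" if "A \<subseteq> B" for A B :: "'a set"
    unfolding hausdorff_outer_def by (intro SUP_mono') (rule hausdorff_pre_mono[OF that])
  moreover have "hausdorff_outer k (\<Union>i. A i) \<le> (\<Sum>i. hausdorff_outer k (A i))"
    for A :: "nat \<Rightarrow> 'a set"
    unfolding hausdorff_outer_def[of k "\<Union>i. A i"]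
  proof (rule SUP_least)
    fix \<delta> :: real assume \<delta>: "\<delta> \<in> {0<..}"
    have "hausdorff_pre k \<delta> (A i) \<le> hausdorff_outer k (A i)" for i
      unfolding hausdorff_outer_def by (rule SUP_upper[OF \<delta>])
    then have "(\<Sum>i. hausdorff_pre k \<delta> (A i)) \<le> (\<Sum>i. hausdorff_outer k (A i))"
      by (intro suminf_le) auto
    with hausdorff_pre_subadditive[of k \<delta> A]
    show "hausdorff_pre k \<delta> (\<Union>i. A i) \<le> (\<Sum>i. hausdorff_outer k (A i))"
      by (rule order_trans)
  qed
  ultimately show ?thesis
    by (auto simp: outer_measure_space_def positive_def increasing_def countably_subadditive_def)
qed

lemma measure_space_hausdorff:
  "measure_space UNIV (lambda_system UNIV UNIV (hausdorff_outer k)) (hausdorff_outer k)"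
  using sigma_algebra.caratheodory_lemma[OF sigma_algebra_Pow, of UNIV "hausdorff_outer k"]
    outer_measure_space_hausdorff[of k] by simp

lemma sets_hausdorff_measure:
  "sets (hausdorff_measure k :: 'a::metric_space measure) =
     lambda_system UNIV UNIV (hausdorff_outer k)"
proof -
  interpret sigma_algebra UNIV "lambda_system UNIV UNIV (hausdorff_outer k :: 'a set \<Rightarrow> ennreal)"
    using measure_space_hausdorff[of k, where 'a = 'a] by (simp add: measure_space_def)
  show ?thesis by (simp add: hausdorff_measure_def)
qed

lemma emeasure_hausdorff_measure:
  fixes A :: "'a::metric_space set"
  assumes "A \<in> sets (hausdorff_measure k)"
  shows "emeasure (hausdorff_measure k) A = hausdorff_outer k A"
  using assms measure_space_hausdorff[of k, where 'a = 'a]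
  unfolding sets_hausdorff_measure
  by (simp add: hausdorff_measure_def measure_space_def emeasure_measure_of_sigma)

definition surface_measure :: "(real ^ 'd) set \<Rightarrow> (real ^ 'd) measure" where
  "surface_measure \<Omega> = restrict_space (hausdorff_measure (CARD('d) - 1)) (frontier \<Omega>)"


section \<open>Bounded Lipschitz domains\<close>

text \<open>
  Near each boundary point \<open>\<Omega>\<close> is, in rotated coordinates, the strict epigraph of a Lipschitz
  function. The unit vector \<open>e\<close> is the vertical direction, and \<open>g\<close> is only used on the
  hyperplane orthogonal to \<open>e\<close>.
\<close>

definition lipschitz_boundary :: "(real ^ 'd) set \<Rightarrow> bool" where
  "lipschitz_boundary \<Omega> \<longleftrightarrow>
     (\<forall>p\<in>frontier \<Omega>. \<exists>r>0. \<exists>e g L.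
        norm e = 1 \<and> L-lipschitz_on {z. z \<bullet> e = 0} g \<and>
        \<Omega> \<inter> ball p r = {y \<in> ball p r. g (y - (y \<bullet> e) *\<^sub>R e) < y \<bullet> e})"

definition bounded_lipschitz_domain :: "(real ^ 'd) set \<Rightarrow> bool" where
  "bounded_lipschitz_domain \<Omega> \<longleftrightarrow>
     open \<Omega> \<and> connected \<Omega> \<and> \<Omega> \<noteq> {} \<and> bounded \<Omega> \<and> lipschitz_boundary \<Omega>"


section \<open>Lebesgue spaces\<close>

text \<open>
  Elements of function spaces are represented by functions on the whole of \<open>real ^ 'd\<close>, of which
  only the values almost everywhere in \<open>\<Omega>\<close> (with respect to \<open>lebesgue_on \<Omega>\<close>) matter.
\<close>

definition square_integrable :: "'a measure \<Rightarrow> ('a \<Rightarrow> 'b::euclidean_space) \<Rightarrow> bool" where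
  "square_integrable M f \<longleftrightarrow> f \<in> borel_measurable M \<and> integrable M (\<lambda>x. (norm (f x))\<^sup>2)"

definition l2_inner :: "'a measure \<Rightarrow> ('a \<Rightarrow> 'b::euclidean_space) \<Rightarrow> ('a \<Rightarrow> 'b) \<Rightarrow> real" where
  "l2_inner M f g = (LINT x|M. f x \<bullet> g x)"

definition l2_norm :: "'a measure \<Rightarrow> ('a \<Rightarrow> 'b::euclidean_space) \<Rightarrow> real" where
  "l2_norm M f = sqrt (l2_inner M f f)"

definition l1_norm :: "'a measure \<Rightarrow> ('a \<Rightarrow> 'b::euclidean_space) \<Rightarrow> real" where
  "l1_norm M f = (LINT x|M. norm (f x))"


section \<open>Sobolev spaces and traces\<close>

primrec cont_diff :: "nat \<Rightarrow> ('a::euclidean_space \<Rightarrow> 'b::real_normed_vector) \<Rightarrow> bool" where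
  "cont_diff 0 f \<longleftrightarrow> continuous_on UNIV f"
| "cont_diff (Suc k) f \<longleftrightarrow>
     (\<forall>x. f differentiable (at x)) \<and>
     (\<forall>h. cont_diff k (\<lambda>x. frechet_derivative f (at x) h))"

definition smooth :: "('a::euclidean_space \<Rightarrow> 'b::real_normed_vector) \<Rightarrow> bool" where
  "smooth f \<longleftrightarrow> (\<forall>k. cont_diff k f)"

definition test_function :: "'a::euclidean_space set \<Rightarrow> ('a \<Rightarrow> real) \<Rightarrow> bool" where
  "test_function \<Omega> \<phi> \<longleftrightarrow>
     smooth \<phi> \<and> compact (closure {x. \<phi> x \<noteq> 0}) \<and> closure {x. \<phi> x \<noteq> 0} \<subseteq> \<Omega>"

text \<open>The entry \<open>G x $ i $ j\<close> is the weak partial derivative of component \<open>i\<close> in direction \<open>j\<close>.\<close>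

definition is_weak_gradient ::
  "(real ^ 'd) set \<Rightarrow> (real ^ 'd \<Rightarrow> real ^ 'l) \<Rightarrow> (real ^ 'd \<Rightarrow> real ^ 'd ^ 'l) \<Rightarrow> bool" where
  "is_weak_gradient \<Omega> u G \<longleftrightarrow>
     (\<forall>\<phi> i j. test_function \<Omega> \<phi> \<longrightarrow>
        (LINT x|lebesgue_on \<Omega>. u x $ i * frechet_derivative \<phi> (at x) (axis j 1)) =
        - (LINT x|lebesgue_on \<Omega>. G x $ i $ j * \<phi> x))"

definition H1 :: "(real ^ 'd) set \<Rightarrow> (real ^ 'd \<Rightarrow> real ^ 'l) set" where
  "H1 \<Omega> = {u. square_integrable (lebesgue_on \<Omega>) u \<and>
     (\<exists>G. square_integrable (lebesgue_on \<Omega>) G \<and> is_weak_gradient \<Omega> u G)}"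

text \<open>
  The weak gradient is unique almost everywhere in \<open>\<Omega>\<close>. Inner products of gradients are thus
  independent of the choice made here; on \<open>real ^ 'd ^ 'l\<close> the inner product is the Frobenius one.
\<close>

definition wgrad :: "(real ^ 'd) set \<Rightarrow> (real ^ 'd \<Rightarrow> real ^ 'l) \<Rightarrow> real ^ 'd \<Rightarrow> real ^ 'd ^ 'l" where
  "wgrad \<Omega> u = (SOME G. square_integrable (lebesgue_on \<Omega>) G \<and> is_weak_gradient \<Omega> u G)"

definition H1_norm :: "(real ^ 'd) set \<Rightarrow> (real ^ 'd \<Rightarrow> real ^ 'l) \<Rightarrow> real" where
  "H1_norm \<Omega> u =
     sqrt ((l2_norm (lebesgue_on \<Omega>) u)\<^sup>2 + (l2_norm (lebesgue_on \<Omega>) (wgrad \<Omega> u))\<^sup>2)"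

text \<open>
  The trace operator from \<open>H1 \<Omega>\<close> to the square integrable functions on the boundary is the
  continuous extension of the restriction map on smooth functions, which are dense in \<open>H1 \<Omega>\<close> for
  a bounded Lipschitz domain. Its graph is therefore the closure of the graph of that map.
\<close>

definition has_trace ::
  "(real ^ 'd) set \<Rightarrow> (real ^ 'd \<Rightarrow> real ^ 'l) \<Rightarrow> (real ^ 'd \<Rightarrow> real ^ 'l) \<Rightarrow> bool" where
  "has_trace \<Omega> u g \<longleftrightarrow>
     u \<in> H1 \<Omega> \<and> square_integrable (surface_measure \<Omega>) g \<and>
     (\<exists>\<phi> :: nat \<Rightarrow> real ^ 'd \<Rightarrow> real ^ 'l.
        (\<forall>k. smooth (\<phi> k)) \<and>
        (\<lambda>k. H1_norm \<Omega> (\<lambda>x. \<phi> k x - u x)) \<longlonglongrightarrow> 0 \<and>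
        (\<lambda>k. l2_norm (surface_measure \<Omega>) (\<lambda>x. \<phi> k x - g x)) \<longlonglongrightarrow> 0)"

definition trace_on_eq ::
  "(real ^ 'd) set \<Rightarrow> (real ^ 'd) set \<Rightarrow> (real ^ 'd \<Rightarrow> real ^ 'l) \<Rightarrow> (real ^ 'd \<Rightarrow> real ^ 'l) \<Rightarrow> bool"
where
  "trace_on_eq \<Omega> \<Gamma> u w \<longleftrightarrow>
     (\<exists>g. has_trace \<Omega> u g \<and> (AE x in surface_measure \<Omega>. x \<in> \<Gamma> \<longrightarrow> g x = w x))"

definition H1D :: "(real ^ 'd) set \<Rightarrow> (real ^ 'd) set \<Rightarrow> (real ^ 'd \<Rightarrow> real ^ 'l) set" where
  "H1D \<Omega> \<Gamma> = {v \<in> H1 \<Omega>. trace_on_eq \<Omega> \<Gamma> v (\<lambda>_. 0)}"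

definition grad_inner ::
  "(real ^ 'd) set \<Rightarrow> (real ^ 'd \<Rightarrow> real ^ 'l) \<Rightarrow> (real ^ 'd \<Rightarrow> real ^ 'l) \<Rightarrow> real" where
  "grad_inner \<Omega> v w = l2_inner (lebesgue_on \<Omega>) (wgrad \<Omega> v) (wgrad \<Omega> w)"


section \<open>The variable-step theta-mu method\<close>

text \<open>
  The index shift in \<open>n - 1\<close> is truncated subtraction: \<open>dt\<close> is meaningful for \<open>n \<ge> 1\<close> and
  \<open>dt2\<close> for \<open>n \<ge> 2\<close>, and they are only used there.
\<close>

definition dt ::
  "(nat \<Rightarrow> real) \<Rightarrow> (nat \<Rightarrow> 'a \<Rightarrow> 'b::real_vector) \<Rightarrow> nat \<Rightarrow> 'a \<Rightarrow> 'b" where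
  "dt \<tau> u n x = (u n x - u (n - 1) x) /\<^sub>R \<tau> n"

definition dt2 ::
  "(nat \<Rightarrow> real) \<Rightarrow> (nat \<Rightarrow> 'a \<Rightarrow> 'b::real_vector) \<Rightarrow> nat \<Rightarrow> 'a \<Rightarrow> 'b" where
  "dt2 \<tau> u n x = (dt \<tau> u n x - dt \<tau> u (n - 1) x) /\<^sub>R \<tau> n"

definition extrapolate ::
  "real \<Rightarrow> (nat \<Rightarrow> real) \<Rightarrow> (nat \<Rightarrow> 'a \<Rightarrow> 'b::real_vector) \<Rightarrow> nat \<Rightarrow> 'a \<Rightarrow> 'b" where
  "extrapolate \<mu> \<tau> u n x = u (n - 1) x + (\<mu> * \<tau> n) *\<^sub>R dt \<tau> u (n - 1) x"

definition tangential ::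
  "(real ^ 'd) set \<Rightarrow> (real ^ 'd) set \<Rightarrow> (real ^ 'd \<Rightarrow> real ^ 'l) \<Rightarrow> (real ^ 'd \<Rightarrow> real ^ 'l) set" where
  "tangential \<Omega> \<Gamma> w = {v \<in> H1D \<Omega> \<Gamma>. AE x in lebesgue_on \<Omega>. v x \<bullet> w x = 0}"

text \<open>
  The update \<open>u n = u (n - 1) + \<tau> n *\<^sub>R dt \<tau> u n\<close> holds by definition of \<open>dt\<close>, so the
  method is expressed as conditions on the sequence \<open>u\<close>.
\<close>

definition theta_mu_method ::
  "(real ^ 'd) set \<Rightarrow> (real ^ 'd) set \<Rightarrow> (real ^ 'd \<Rightarrow> real ^ 'l) \<Rightarrow>
   ((real ^ 'd \<Rightarrow> real ^ 'l) \<Rightarrow> (real ^ 'd \<Rightarrow> real ^ 'l) \<Rightarrow> real) \<Rightarrow>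
   real \<Rightarrow> real \<Rightarrow> (nat \<Rightarrow> real) \<Rightarrow> (nat \<Rightarrow> real ^ 'd \<Rightarrow> real ^ 'l) \<Rightarrow> bool" where
  "theta_mu_method \<Omega> \<Gamma>\<^sub>D u\<^sub>D star \<theta> \<mu> \<tau> u \<longleftrightarrow>
     u 0 \<in> H1 \<Omega> \<and> trace_on_eq \<Omega> \<Gamma>\<^sub>D (u 0) u\<^sub>D \<and>
     dt \<tau> u 1 \<in> tangential \<Omega> \<Gamma>\<^sub>D (u 0) \<and>
     (\<forall>v\<in>tangential \<Omega> \<Gamma>\<^sub>D (u 0).
        star (dt \<tau> u 1) v +
        l2_inner (lebesgue_on \<Omega>)
          (\<lambda>x. wgrad \<Omega> (u 0) x + \<tau> 1 *\<^sub>R wgrad \<Omega> (dt \<tau> u 1) x) (wgrad \<Omega> v) = 0) \<and>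
     (\<forall>n\<ge>2.
        dt \<tau> u n \<in> tangential \<Omega> \<Gamma>\<^sub>D (extrapolate \<mu> \<tau> u n) \<and>
        (\<forall>v\<in>tangential \<Omega> \<Gamma>\<^sub>D (extrapolate \<mu> \<tau> u n).
           star (dt \<tau> u n) v +
           l2_inner (lebesgue_on \<Omega>)
             (wgrad \<Omega> (\<lambda>x. u (n - 1) x + (\<theta> * \<tau> n) *\<^sub>R dt \<tau> u n x)) (wgrad \<Omega> v) = 0))"

end

theory Submission
  imports Defs
begin

text \<open>
  Orthogonality of \<open>d\<^sub>tu\<^sup>n\<close> to the extrapolated value turns the increment
  \<open>|u\<^sup>n|\<^sup>2 - |u\<^sup>n\<^sup>-\<^sup>1|\<^sup>2\<close> into
  \<open>\<tau>\<^sub>n\<^sup>2 (|d\<^sub>tu\<^sup>n|\<^sup>2 - 2 \<mu> d\<^sub>tu\<^sup>n \<bullet> d\<^sub>tu\<^sup>n\<^sup>-\<^sup>1)\<close>. Polarising the mixed term produces the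
  second difference, and the remaining squares \<open>\<mu> \<tau>\<^sub>n\<^sup>2 (|d\<^sub>tu\<^sup>n|\<^sup>2 - |d\<^sub>tu\<^sup>n\<^sup>-\<^sup>1|\<^sup>2)\<close> telescope up to
  the factors \<open>1 - s\<^sub>n\<^sup>2\<close>. The \<open>L\<^sup>1\<close> estimate is the integrated triangle inequality.
\<close>

lemma square_integrable_scaleR:
  assumes "square_integrable M f"
  shows "square_integrable M (\<lambda>x. c *\<^sub>R f x)"
  using assms by (auto simp: square_integrable_def power_mult_distrib)

text \<open>The sum is dominated through the parallelogram law: \<open>2|a|^2 + 2|b|^2\<close>
  exceeds \<open>|a + b|^2\<close> by exactly \<open>|a - b|^2\<close>.\<close>

lemma square_integrable_add:
  assumes f: "square_integrable M f" and g: "square_integrable M g"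
  shows "square_integrable M (\<lambda>x. f x + g x)"
proof -
  have [measurable]: "f \<in> borel_measurable M" "g \<in> borel_measurable M"
    using f g by (auto simp: square_integrable_def)
  have "(norm (a + b))\<^sup>2 \<le> 2 * (norm a)\<^sup>2 + 2 * (norm b)\<^sup>2" for a b :: 'b
    using zero_le_power2[of "norm (a - b)"]
    by (simp add: power2_norm_eq_inner algebra_simps inner_commute)
  moreover have "integrable M (\<lambda>x. 2 * (norm (f x))\<^sup>2 + 2 * (norm (g x))\<^sup>2)"
    using f g by (auto simp: square_integrable_def)
  ultimately have "integrable M (\<lambda>x. (norm (f x + g x))\<^sup>2)"
    by (elim Bochner_Integration.integrable_bound) auto
  then show ?thesis by (simp add: square_integrable_def)
qed

lemma square_integrable_diff:
  assumes "square_integrable M f" "square_integrable M g"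
  shows "square_integrable M (\<lambda>x. f x - g x)"
  using square_integrable_add[OF assms(1) square_integrable_scaleR[OF assms(2), of "-1"]] by simp

lemma l2_norm_squared: "(l2_norm M f)\<^sup>2 = (LINT x|M. (norm (f x))\<^sup>2)"
  by (simp add: l2_norm_def l2_inner_def power2_norm_eq_inner)

lemma dt_update:
  assumes "\<tau> n \<noteq> 0"
  shows "u n x = u (n - 1) x + \<tau> n *\<^sub>R dt \<tau> u n x"
  using assms by (simp add: dt_def)

lemma dt_diff_dt:
  assumes "\<tau> n \<noteq> 0"
  shows "dt \<tau> u n x - dt \<tau> u (n - 1) x = \<tau> n *\<^sub>R dt2 \<tau> u n x"
  using assms by (simp add: dt2_def)

text \<open>With \<open>a\<close>, \<open>b\<close> the new and old difference quotients,
  polarisation gives \<open>-2 a \<bullet> b = |a - b|^2 - 2 |a|^2 + (|a|^2 - |b|^2)\<close>. The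
  middle square produces the coefficient \<open>1 - 2 * \<mu>\<close>. The bracket is kept as a
  difference so that it can telescope.\<close>

lemma norm_squared_step:
  fixes u :: "nat \<Rightarrow> 'a \<Rightarrow> 'b::real_inner"
  assumes tau: "\<tau> n \<noteq> 0" and orth: "dt \<tau> u n x \<bullet> extrapolate \<mu> \<tau> u n x = 0"
  shows "(norm (u n x))\<^sup>2 = (norm (u (n - 1) x))\<^sup>2 + (1 - 2 * \<mu>) * (\<tau> n)\<^sup>2 * (norm (dt \<tau> u n x))\<^sup>2
    + \<mu> * (\<tau> n) ^ 4 * (norm (dt2 \<tau> u n x))\<^sup>2
    + \<mu> * (\<tau> n)\<^sup>2 * ((norm (dt \<tau> u n x))\<^sup>2 - (norm (dt \<tau> u (n - 1) x))\<^sup>2)"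
proof -
  define a b v where "a = dt \<tau> u n x" and "b = dt \<tau> u (n - 1) x" and "v = u (n - 1) x"
  have mixed: "a \<bullet> v = - \<mu> * \<tau> n * (a \<bullet> b)"
    using orth by (simp add: extrapolate_def a_def b_def v_def inner_right_distrib)
  have "(norm (u n x))\<^sup>2 = (norm v)\<^sup>2 + 2 * \<tau> n * (a \<bullet> v) + (\<tau> n)\<^sup>2 * (norm a)\<^sup>2"
    unfolding dt_update[of \<tau> n u x, OF tau] a_def[symmetric] v_def[symmetric] power2_norm_eq_inner
    by (simp add: algebra_simps power2_eq_square inner_commute)
  \<comment> \<open>Both sides equal \<open>|a - b|^2\<close>. A further factor
    \<open>\<mu> * (\<tau> n)\<^sup>2\<close> then yields the fourth power of the step size.\<close>
  moreover have "(\<tau> n)\<^sup>2 * (norm (dt2 \<tau> u n x))\<^sup>2 = (norm a)\<^sup>2 - 2 * (a \<bullet> b) + (norm b)\<^sup>2"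
    using arg_cong[OF dt_diff_dt[of \<tau> n u x, OF tau], of "\<lambda>w. w \<bullet> w"]
    unfolding a_def[symmetric] b_def[symmetric] power2_norm_eq_inner
    by (simp add: algebra_simps power2_eq_square inner_commute)
  then have "\<mu> * (\<tau> n) ^ 4 * (norm (dt2 \<tau> u n x))\<^sup>2
      = \<mu> * (\<tau> n)\<^sup>2 * ((norm a)\<^sup>2 - 2 * (a \<bullet> b) + (norm b)\<^sup>2)"
    by (metis (no_types, lifting) mult.assoc power2_eq_square power4_eq_xxxx)
  ultimately show ?thesis
    unfolding a_def[symmetric] b_def[symmetric] v_def[symmetric] mixed
    by (simp add: algebra_simps power2_eq_square)
qed

text \<open>Induction starts at \<open>m = 1\<close>, where the Euler step already fits the formula:
  the sums are empty and the weights \<open>\<mu>\<close> and \<open>1 - \<mu>\<close> of the first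
  increment add up to one. The argument is pointwise in \<open>x\<close>, so null sets enter only
  later.\<close>

lemma norm_squared_identity:
  fixes u :: "nat \<Rightarrow> 'a \<Rightarrow> 'b::real_inner"
  assumes m: "1 \<le> m"
    and tau: "\<And>n. 1 \<le> n \<Longrightarrow> \<tau> n \<noteq> 0"
    and ratio: "\<And>n. 2 \<le> n \<Longrightarrow> s n = \<tau> n / \<tau> (n - 1)"
    and orth1: "dt \<tau> u 1 x \<bullet> u 0 x = 0"
    and orth: "\<And>n. 2 \<le> n \<Longrightarrow> dt \<tau> u n x \<bullet> extrapolate \<mu> \<tau> u n x = 0"
  shows "(norm (u m x))\<^sup>2 - (norm (u 0 x))\<^sup>2 =
           \<mu> * (\<tau> m)\<^sup>2 * (norm (dt \<tau> u m x))\<^sup>2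
           + (1 - \<mu>) * (\<tau> 1)\<^sup>2 * (norm (dt \<tau> u 1 x))\<^sup>2
           + \<mu> * (\<Sum>n=1..m-1. (\<tau> n)\<^sup>2 * (1 - (s (n + 1))\<^sup>2) * (norm (dt \<tau> u n x))\<^sup>2)
           + \<mu> * (\<Sum>n=2..m. (\<tau> n) ^ 4 * (norm (dt2 \<tau> u n x))\<^sup>2)
           + (1 - 2 * \<mu>) * (\<Sum>n=2..m. (\<tau> n)\<^sup>2 * (norm (dt \<tau> u n x))\<^sup>2)"
  using m
proof (induction m rule: dec_induct)
  case base
  have "(norm (u 1 x))\<^sup>2 = (norm (u 0 x))\<^sup>2 + (\<tau> 1)\<^sup>2 * (norm (dt \<tau> u 1 x))\<^sup>2"
    using orth1 dt_update[of \<tau> 1 u x] tau[of 1] unfolding power2_norm_eq_inner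
    by (simp add: algebra_simps power2_eq_square inner_commute)
  then show ?case by (simp add: algebra_simps)
next
  case (step k)
  define S where "S l = (\<Sum>n=1..l-1. (\<tau> n)\<^sup>2 * (1 - (s (n + 1))\<^sup>2) * (norm (dt \<tau> u n x))\<^sup>2)" for l
  define T where "T l = (\<Sum>n=2..l. (\<tau> n) ^ 4 * (norm (dt2 \<tau> u n x))\<^sup>2)" for l
  define U where "U l = (\<Sum>n=2..l. (\<tau> n)\<^sup>2 * (norm (dt \<tau> u n x))\<^sup>2)" for l
  \<comment> \<open>The ratio cancels the older step size, so the new summand of \<open>S\<close>
    has the coefficient \<open>\<tau>_k^2 - \<tau>_(k+1)^2\<close>.\<close>
  have "s (Suc k) * \<tau> k = \<tau> (Suc k)"
    using step.hyps ratio[of "Suc k"] tau[of k] by simp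
  then have scale: "(\<tau> k)\<^sup>2 * (1 - (s (Suc k))\<^sup>2) = (\<tau> k)\<^sup>2 - (\<tau> (Suc k))\<^sup>2"
    by (metis mult.commute mult.right_neutral power_mult_distrib right_diff_distrib)
  \<comment> \<open>The upper limit \<open>l - 1\<close> is truncated subtraction; splitting on
    \<open>k\<close>, which is at least 1, exposes the last summand.\<close>
  have S: "S (Suc k) = S k + ((\<tau> k)\<^sup>2 - (\<tau> (Suc k))\<^sup>2) * (norm (dt \<tau> u k x))\<^sup>2"
    using step.hyps scale by (cases k) (simp_all add: S_def)
  have T: "T (Suc k) = T k + (\<tau> (Suc k)) ^ 4 * (norm (dt2 \<tau> u (Suc k) x))\<^sup>2"
    and U: "U (Suc k) = U k + (\<tau> (Suc k))\<^sup>2 * (norm (dt \<tau> u (Suc k) x))\<^sup>2"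
    using step.hyps by (simp_all add: T_def U_def)
  have "(norm (u (Suc k) x))\<^sup>2 = (norm (u k x))\<^sup>2
      + (1 - 2 * \<mu>) * (\<tau> (Suc k))\<^sup>2 * (norm (dt \<tau> u (Suc k) x))\<^sup>2
      + \<mu> * (\<tau> (Suc k)) ^ 4 * (norm (dt2 \<tau> u (Suc k) x))\<^sup>2
      + \<mu> * (\<tau> (Suc k))\<^sup>2 * ((norm (dt \<tau> u (Suc k) x))\<^sup>2 - (norm (dt \<tau> u k x))\<^sup>2)"
    using norm_squared_step[of \<tau> "Suc k" u x \<mu>] tau[of "Suc k"] orth[of "Suc k"] step.hyps by simp
  \<comment> \<open>The old end term \<open>\<mu> \<tau>_k^2 |dt_k|^2\<close> and the negative part
    \<open>-\<mu> \<tau>_(k+1)^2 |dt_k|^2\<close> of the increment merge into the new summand of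
    \<open>S\<close>; the positive part becomes the new end term.\<close>
  then show ?case
    using step.IH unfolding S_def[symmetric] T_def[symmetric] U_def[symmetric] S T U
    by (simp add: algebra_simps)
qed

theorem proposition3p2:
  fixes \<Omega> \<Gamma>\<^sub>D :: "(real ^ 'd) set"
    and u\<^sub>D utilde\<^sub>D :: "real ^ 'd \<Rightarrow> real ^ 'l"
    and star :: "(real ^ 'd \<Rightarrow> real ^ 'l) \<Rightarrow> (real ^ 'd \<Rightarrow> real ^ 'l) \<Rightarrow> real"
    and c_star \<theta> \<mu> :: real
    and \<tau> s :: "nat \<Rightarrow> real"
    and u :: "nat \<Rightarrow> real ^ 'd \<Rightarrow> real ^ 'l"
  assumes domain: "bounded_lipschitz_domain \<Omega>"
    and Gamma_D: "\<Gamma>\<^sub>D \<subseteq> frontier \<Omega>" "\<Gamma>\<^sub>D \<in> sets (surface_measure \<Omega>)"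
      "emeasure (surface_measure \<Omega>) \<Gamma>\<^sub>D > 0"
    and u_D: "utilde\<^sub>D \<in> H1 \<Omega>" "AE x in lebesgue_on \<Omega>. norm (utilde\<^sub>D x) = 1"
      "trace_on_eq \<Omega> \<Gamma>\<^sub>D utilde\<^sub>D u\<^sub>D"
    and star: "star = l2_inner (lebesgue_on \<Omega>) \<or> star = grad_inner \<Omega>"
    and c_star: "c_star > 0"
      "\<forall>v\<in>H1D \<Omega> \<Gamma>\<^sub>D. l2_norm (lebesgue_on \<Omega>) v \<le> sqrt c_star * sqrt (star v v)"
    and theta: "0 < \<theta>" "\<theta> \<le> 1"
    and mu: "0 \<le> \<mu>" "\<mu> \<le> 1"
    and tau: "\<forall>n\<ge>1. \<tau> n > 0"
    and ratio: "\<forall>n\<ge>2. s n = \<tau> n / \<tau> (n - 1)"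
    and scheme: "theta_mu_method \<Omega> \<Gamma>\<^sub>D u\<^sub>D star \<theta> \<mu> \<tau> u"
    and unit: "AE x in lebesgue_on \<Omega>. norm (u 0 x) = 1"
  shows "\<forall>m\<ge>2.
      (AE x in lebesgue_on \<Omega>.
         (norm (u m x))\<^sup>2 - 1 =
           \<mu> * (\<tau> m)\<^sup>2 * (norm (dt \<tau> u m x))\<^sup>2
           + (1 - \<mu>) * (\<tau> 1)\<^sup>2 * (norm (dt \<tau> u 1 x))\<^sup>2
           + \<mu> * (\<Sum>n=1..m-1. (\<tau> n)\<^sup>2 * (1 - (s (n + 1))\<^sup>2) * (norm (dt \<tau> u n x))\<^sup>2)
           + \<mu> * (\<Sum>n=2..m. (\<tau> n) ^ 4 * (norm (dt2 \<tau> u n x))\<^sup>2)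
           + (1 - 2 * \<mu>) * (\<Sum>n=2..m. (\<tau> n)\<^sup>2 * (norm (dt \<tau> u n x))\<^sup>2))
      \<and> integrable (lebesgue_on \<Omega>) (\<lambda>x. (norm (u m x))\<^sup>2 - 1)
      \<and> l1_norm (lebesgue_on \<Omega>) (\<lambda>x. (norm (u m x))\<^sup>2 - 1)
          \<le> \<mu> * (\<tau> m)\<^sup>2 * (l2_norm (lebesgue_on \<Omega>) (dt \<tau> u m))\<^sup>2
            + (1 - \<mu>) * (\<tau> 1)\<^sup>2 * (l2_norm (lebesgue_on \<Omega>) (dt \<tau> u 1))\<^sup>2
            + \<mu> * (\<Sum>n=1..m-1. (\<tau> n)\<^sup>2 * \<bar>1 - (s (n + 1))\<^sup>2\<bar>
                                * (l2_norm (lebesgue_on \<Omega>) (dt \<tau> u n))\<^sup>2)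
            + \<mu> * (\<Sum>n=2..m. (\<tau> n) ^ 4 * (l2_norm (lebesgue_on \<Omega>) (dt2 \<tau> u n))\<^sup>2)
            + \<bar>1 - 2 * \<mu>\<bar> * (\<Sum>n=2..m. (\<tau> n)\<^sup>2 * (l2_norm (lebesgue_on \<Omega>) (dt \<tau> u n))\<^sup>2)"
proof (intro allI impI)
  fix m :: nat
  assume m: "2 \<le> m"
  let ?M = "lebesgue_on \<Omega>"
  let ?a = "\<lambda>n x. (norm (dt \<tau> u n x))\<^sup>2"
  let ?b = "\<lambda>n x. (norm (dt2 \<tau> u n x))\<^sup>2"
  let ?R = "\<lambda>x. \<mu> * (\<tau> m)\<^sup>2 * ?a m x + (1 - \<mu>) * (\<tau> 1)\<^sup>2 * ?a 1 x
    + \<mu> * (\<Sum>n=1..m-1. (\<tau> n)\<^sup>2 * (1 - (s (n + 1))\<^sup>2) * ?a n x)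
    + \<mu> * (\<Sum>n=2..m. (\<tau> n) ^ 4 * ?b n x)
    + (1 - 2 * \<mu>) * (\<Sum>n=2..m. (\<tau> n)\<^sup>2 * ?a n x)"
  let ?B = "\<lambda>x. \<mu> * (\<tau> m)\<^sup>2 * ?a m x + (1 - \<mu>) * (\<tau> 1)\<^sup>2 * ?a 1 x
    + \<mu> * (\<Sum>n=1..m-1. (\<tau> n)\<^sup>2 * \<bar>1 - (s (n + 1))\<^sup>2\<bar> * ?a n x)
    + \<mu> * (\<Sum>n=2..m. (\<tau> n) ^ 4 * ?b n x)
    + \<bar>1 - 2 * \<mu>\<bar> * (\<Sum>n=2..m. (\<tau> n)\<^sup>2 * ?a n x)"
  have tau0: "\<tau> n \<noteq> 0" if "1 \<le> n" for n
    using tau that by force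
  have tan1: "dt \<tau> u 1 \<in> tangential \<Omega> \<Gamma>\<^sub>D (u 0)"
    and tan: "\<And>n. 2 \<le> n \<Longrightarrow> dt \<tau> u n \<in> tangential \<Omega> \<Gamma>\<^sub>D (extrapolate \<mu> \<tau> u n)"
    and u0: "u 0 \<in> H1 \<Omega>"
    using scheme by (auto simp: theta_mu_method_def)
  have sq_dt: "square_integrable ?M (dt \<tau> u n)" if "1 \<le> n" for n
  proof (cases "n = 1")
    case True
    with tan1 show ?thesis by (auto simp: tangential_def H1D_def H1_def)
  next
    case False
    with that tan[of n] show ?thesis by (auto simp: tangential_def H1D_def H1_def)
  qed
  have sq_dt2: "square_integrable ?M (dt2 \<tau> u n)" if "2 \<le> n" for n
    unfolding dt2_def[abs_def]
    using that by (intro square_integrable_scaleR square_integrable_diff sq_dt) auto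
  \<comment> \<open>The scheme places only \<open>u 0\<close> and the difference quotients in
    Sobolev spaces; the iterates inherit square integrability through the update.\<close>
  have sq_u: "square_integrable ?M (u n)" for n
  proof (induction n)
    case 0
    show ?case using u0 by (simp add: H1_def)
  next
    case (Suc n)
    have "u (Suc n) = (\<lambda>x. u n x + \<tau> (Suc n) *\<^sub>R dt \<tau> u (Suc n) x)"
      using dt_update[of \<tau> "Suc n" u] tau0[of "Suc n"] by auto
    then show ?case
      using Suc sq_dt[of "Suc n"] by (simp add: square_integrable_add square_integrable_scaleR)
  qed
  have int_a: "integrable ?M (?a n)" if "1 \<le> n" for n
    using sq_dt[OF that] by (simp add: square_integrable_def)
  have int_b: "integrable ?M (?b n)" if "2 \<le> n" for n
    using sq_dt2[OF that] by (simp add: square_integrable_def)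
  \<comment> \<open>Countably many exceptional null sets are merged into one, so that the pointwise
    identity can be applied at almost every \<open>x\<close>.\<close>
  have "AE x in ?M. \<forall>n. 2 \<le> n \<longrightarrow> dt \<tau> u n x \<bullet> extrapolate \<mu> \<tau> u n x = 0"
    using tan by (auto simp: AE_all_countable tangential_def)
  moreover have "AE x in ?M. dt \<tau> u 1 x \<bullet> u 0 x = 0"
    using tan1 by (simp add: tangential_def)
  ultimately have identity: "AE x in ?M. (norm (u m x))\<^sup>2 - 1 = ?R x"
    using unit
  proof eventually_elim
    case (elim x)
    then show ?case
      using norm_squared_identity[of m \<tau> s u x \<mu>] m tau0 ratio by simp
  qed
  have int_R: "integrable ?M ?R"
    using m by (intro Bochner_Integration.integrable_add integrable_mult_right
        Bochner_Integration.integrable_sum int_a int_b) auto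
  \<comment> \<open>\<open>?I\<close> is the integral of \<open>?B\<close> taken term by term;
    \<open>has_bochner_integral\<close> delivers integrability and value at once.\<close>
  let ?I = "\<mu> * (\<tau> m)\<^sup>2 * (LINT x|?M. ?a m x) + (1 - \<mu>) * (\<tau> 1)\<^sup>2 * (LINT x|?M. ?a 1 x)
    + \<mu> * (\<Sum>n=1..m-1. (\<tau> n)\<^sup>2 * \<bar>1 - (s (n + 1))\<^sup>2\<bar> * (LINT x|?M. ?a n x))
    + \<mu> * (\<Sum>n=2..m. (\<tau> n) ^ 4 * (LINT x|?M. ?b n x))
    + \<bar>1 - 2 * \<mu>\<bar> * (\<Sum>n=2..m. (\<tau> n)\<^sup>2 * (LINT x|?M. ?a n x))"
  have B: "has_bochner_integral ?M ?B ?I"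
    using m by (intro has_bochner_integral_add has_bochner_integral_mult_right
        has_bochner_integral_sum has_bochner_integral_integrable int_a int_b) auto
  then have int_B: "integrable ?M ?B"
    by (rule integrable.intros)
  have [measurable]: "u m \<in> borel_measurable ?M"
    using sq_u by (simp add: square_integrable_def)
  have "integrable ?M (\<lambda>x. (norm (u m x))\<^sup>2 - 1) \<longleftrightarrow> integrable ?M ?R"
    using identity int_R by (intro integrable_cong_AE) auto
  with int_R have int_u: "integrable ?M (\<lambda>x. (norm (u m x))\<^sup>2 - 1)" by blast
  \<comment> \<open>Only the factors \<open>1 - s^2\<close> and \<open>1 - 2 * \<mu>\<close> can be
    negative; since \<mu> lies between 0 and 1, all other coefficients pass unchanged through the
    absolute value.\<close>
  have R_le_B: "\<bar>?R x\<bar> \<le> ?B x" for x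
    using mu
    by (intro order_trans[OF abs_triangle_ineq] add_mono)
      (auto simp: abs_mult intro!: mult_left_mono order_trans[OF sum_abs] sum_mono)
  have "l1_norm ?M (\<lambda>x. (norm (u m x))\<^sup>2 - 1) \<le> (LINT x|?M. ?B x)"
    unfolding l1_norm_def real_norm_def
  proof (rule integral_mono_AE)
    show "AE x in ?M. \<bar>(norm (u m x))\<^sup>2 - 1\<bar> \<le> ?B x"
      using identity by eventually_elim (use R_le_B in presburger)
  qed (use int_u int_B in auto)
  also have "(LINT x|?M. ?B x) = ?I"
    using B by (rule has_bochner_integral_integral_eq)
  finally show "(AE x in ?M. (norm (u m x))\<^sup>2 - 1 = ?R x)
      \<and> integrable ?M (\<lambda>x. (norm (u m x))\<^sup>2 - 1)
      \<and> l1_norm ?M (\<lambda>x. (norm (u m x))\<^sup>2 - 1)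
          \<le> \<mu> * (\<tau> m)\<^sup>2 * (l2_norm ?M (dt \<tau> u m))\<^sup>2
            + (1 - \<mu>) * (\<tau> 1)\<^sup>2 * (l2_norm ?M (dt \<tau> u 1))\<^sup>2
            + \<mu> * (\<Sum>n=1..m-1. (\<tau> n)\<^sup>2 * \<bar>1 - (s (n + 1))\<^sup>2\<bar> * (l2_norm ?M (dt \<tau> u n))\<^sup>2)
            + \<mu> * (\<Sum>n=2..m. (\<tau> n) ^ 4 * (l2_norm ?M (dt2 \<tau> u n))\<^sup>2)
            + \<bar>1 - 2 * \<mu>\<bar> * (\<Sum>n=2..m. (\<tau> n)\<^sup>2 * (l2_norm ?M (dt \<tau> u n))\<^sup>2)"
    unfolding l2_norm_squared using identity int_u by blast
qed

end
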